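(* Let $\mathcal{D}$ be a domain set such that $\operatorname{conv}(\mathcal{D})$ contains no line, let $$V_{\rm rel}:=\min_{X\in\operatorname{conv}(\mathcal{D})}\{\langle A_0,X\rangle:\ b_i^l\le\langle A_i,X\rangle\le b_i^u,\ \forall i\in[m]\}\qquad\text{(LSOP-R)}$$ and suppose $V_{\rm rel}>-\infty$. Let $\epsilon>0$. If the column generation algorithm (described in the context) with optimality gap $\epsilon$ returns $X^*$, then $X^*$ is $\epsilon$-optimal for LSOP-R, that is, $$V_{\rm rel}\le\langle A_0,X^*\rangle\le V_{\rm rel}+\epsilon .$$
   Context: $k\le n\le p$ are positive integers; $[m]=\{1,\dots,m\}$; $\langle\cdot,\cdot\rangle$ is the Frobenius inner product; $\operatorname{conv}$ denotes convex hull. $\mathcal{D}=\{X\in\mathcal{Q}:\operatorname{rank}(X)\le k,\ f(\lambda(X))\le0\}$, where $\mathcal{Q}$ is $\mathcal{S}_+^n$ (positive semidefinite matrices), $\mathcal{S}^n$ (real symmetric matrices) or $\mathbb{R}^{n\times p}$, $\lambda(X)\in\mathbb{R}^n$ is the vector of eigenvalues (singular values if $\mathcal{Q}=\mathbb{R}^{n\times p}$) of $X$, and $f:\mathbb{R}^n\to\mathbb{R}$ is continuous, convex and symmetric. $A_0,\dots,A_m$ are real matrices of the size of elements of $\mathcal{Q}$ (symmetric if $\mathcal{Q}$ consists of symmetric matrices) and $-\infty\le b_i^l\le b_i^u\le+\infty$. Column generation algorithm. It maintains a finite list of points $\{X_h\}_{h\in\mathcal{H}}\subseteq\operatorname{conv}(\mathcal{D})$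 and a finite list of directions $\{d_j\}_{j\in\mathcal{J}}$ of recession of $\operatorname{conv}(\mathcal{D})$, starting from one point $X_1$ feasible for LSOP-R and no directions. Each iteration does the following. 1. Solve the restricted master linear program (RMP) $$\min_{\alpha\in\mathbb{R}_+^{|\mathcal{H}|},\,\gamma\in\mathbb{R}_+^{|\mathcal{J}|}}\Big\{\sum_{h}\alpha_h\langle A_0,X_h\rangle+\sum_j\gamma_j\langle A_0,d_j\rangle:\ \sum_h\alpha_h=1,\ b_i^l\le\sum_h\alpha_h\langle A_i,X_h\rangle+\sum_j\gamma_j\langle A_i,d_j\rangle\le b_i^u\ \forall i\in[m]\Big\},$$ obtaining an optimal solution $(\alpha^*,\gamma^* )$ and an optimal solution $(\nu^*,(\mu^l)^*,(\mu^u)^* )$ of its dual $$\max_{\nu\in\mathbb{R},\,\mu^l,\mu^u\in\mathbb{R}_+^m}\Big\{-\nu+(b^l)^\top\mu^l-(b^u)^\top\mu^u:\ \nu\ge\Big\langle-A_0+\sum_i(\mu_i^l-\mu_i^u)A_i,X_h\Big\rangle\ \forall h\in\mathcal{H},\ 0\ge\Big\langle-A_0+\sum_i(\mu_i^l-\mu_i^u)A_i,d_j\Big\rangle\ \forall j\in\mathcal{J}\Big\}$$ (multipliers of infinite bounds are $0$). 2. Set $X^*:=\sum_h\alpha_h^*X_h+\sum_j\gamma_j^*d_j$. 3. Solve the pricing problem $V_{\rm P}:=\max_{X\in\operatorname{conv}(\mathcal{D})}\langle-A_0+\sum_i((\mu_i^l)^*-(\mu_i^u)^* )A_i,X\rangle$.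 If $V_{\rm P}=\infty$, add to the list of directions a recession direction of $\operatorname{conv}(\mathcal{D})$ along which the pricing objective increases and iterate; else if $V_{\rm P}>\nu^*+\epsilon$, add an optimal solution of the pricing problem to the list of points and iterate; else (i.e. $V_{\rm P}\le\nu^*+\epsilon$) terminate and return $X^*$. *)

theory Defs
  imports "HOL-Analysis.Analysis"
begin

text \<open>
  Matrices are elements of \<open>real^'p^'n\<close> (rows indexed by \<open>'n\<close>, columns by \<open>'p\<close>), on which the
  inner product \<open>\<bullet>\<close> of the library is the Frobenius inner product.
\<close>

definition symmetric_matrices :: "(real^'n^'n) set" where
  "symmetric_matrices = {X. transpose X = X}"

definition psd_matrices :: "(real^'n^'n) set" where
  "psd_matrices = {X. transpose X = X \<and> (\<forall>v. 0 \<le> v \<bullet> (X *v v))}"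

text \<open>
  The eigenvalues of a real matrix whose characteristic polynomial splits over the reals (in
  particular of a symmetric matrix), listed with multiplicity. This determines the vector only up
  to a permutation of its entries; it is only used below as an argument of symmetric functions.
\<close>
definition eigenvalues :: "real^'n^'n \<Rightarrow> real^'n" where
  "eigenvalues X = (SOME l. \<forall>t. det (mat t - X) = (\<Prod>i\<in>UNIV. t - l $ i))"

text \<open>Intended for \<open>CARD('n) \<le> CARD('p)\<close>, when there are \<open>CARD('n)\<close> singular values.\<close>
definition singular_values :: "real^'p^'n \<Rightarrow> real^'n" where
  "singular_values X = (\<chi> i. sqrt (eigenvalues (X ** transpose X) $ i))"

definition symmetric_function :: "(real^'n \<Rightarrow> real) \<Rightarrow> bool" where
  "symmetric_function f \<longleftrightarrow> (\<forall>\<sigma> x. bij \<sigma> \<longrightarrow> f (\<chi> i. x $ \<sigma> i) = f x)"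

definition spectral_domain ::
    "(real^'n^'n) set \<Rightarrow> nat \<Rightarrow> (real^'n \<Rightarrow> real) \<Rightarrow> (real^'n^'n) set" where
  "spectral_domain Q k f = {X \<in> Q. rank X \<le> k \<and> f (eigenvalues X) \<le> 0}"

definition singular_domain :: "nat \<Rightarrow> (real^'n \<Rightarrow> real) \<Rightarrow> (real^'p^'n) set" where
  "singular_domain k f = {X. rank X \<le> k \<and> f (singular_values X) \<le> 0}"

definition contains_line :: "'a::real_vector set \<Rightarrow> bool" where
  "contains_line C \<longleftrightarrow> (\<exists>x d. d \<noteq> 0 \<and> (\<forall>t::real. x + t *\<^sub>R d \<in> C))"

definition recession_cone :: "'a::real_vector set \<Rightarrow> 'a set" where
  "recession_cone C = {d. \<forall>x\<in>C. \<forall>t\<ge>0. x + t *\<^sub>R d \<in> C}"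

text \<open>
  \<open>A 0\<close> is the objective; \<open>A 1, \<dots>, A m\<close> are the constraint matrices.
\<close>
locale lsop =
  fixes D :: "'a::real_inner set"
    and m :: nat
    and A :: "nat \<Rightarrow> 'a"
    and bl bu :: "nat \<Rightarrow> ereal"
begin

definition feasible :: "'a \<Rightarrow> bool" where
  "feasible X \<longleftrightarrow> X \<in> convex hull D \<and>
     (\<forall>i\<in>{1..m}. bl i \<le> ereal (A i \<bullet> X) \<and> ereal (A i \<bullet> X) \<le> bu i)"

definition V_rel :: ereal where
  "V_rel = (INF X\<in>{X. feasible X}. ereal (A 0 \<bullet> X))"

definition eps_optimal :: "real \<Rightarrow> 'a \<Rightarrow> bool" where
  "eps_optimal \<epsilon> X \<longleftrightarrow> feasible X \<and>
     V_rel \<le> ereal (A 0 \<bullet> X) \<and> ereal (A 0 \<bullet> X) \<le> V_rel + ereal \<epsilon>"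

definition rmp_objective ::
    "'a list \<Rightarrow> 'a list \<Rightarrow> (nat \<Rightarrow> real) \<Rightarrow> (nat \<Rightarrow> real) \<Rightarrow> real" where
  "rmp_objective Xs ds \<alpha> \<gamma> =
     (\<Sum>h<length Xs. \<alpha> h * (A 0 \<bullet> Xs ! h)) + (\<Sum>j<length ds. \<gamma> j * (A 0 \<bullet> ds ! j))"

definition rmp_feasible ::
    "'a list \<Rightarrow> 'a list \<Rightarrow> (nat \<Rightarrow> real) \<Rightarrow> (nat \<Rightarrow> real) \<Rightarrow> bool" where
  "rmp_feasible Xs ds \<alpha> \<gamma> \<longleftrightarrow>
     (\<forall>h<length Xs. 0 \<le> \<alpha> h) \<and> (\<forall>j<length ds. 0 \<le> \<gamma> j) \<and>
     (\<Sum>h<length Xs. \<alpha> h) = 1 \<and>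
     (\<forall>i\<in>{1..m}.
        let s = (\<Sum>h<length Xs. \<alpha> h * (A i \<bullet> Xs ! h)) + (\<Sum>j<length ds. \<gamma> j * (A i \<bullet> ds ! j))
        in bl i \<le> ereal s \<and> ereal s \<le> bu i)"

definition rmp_optimal ::
    "'a list \<Rightarrow> 'a list \<Rightarrow> (nat \<Rightarrow> real) \<Rightarrow> (nat \<Rightarrow> real) \<Rightarrow> bool" where
  "rmp_optimal Xs ds \<alpha> \<gamma> \<longleftrightarrow> rmp_feasible Xs ds \<alpha> \<gamma> \<and>
     (\<forall>\<alpha>' \<gamma>'. rmp_feasible Xs ds \<alpha>' \<gamma>' \<longrightarrow> rmp_objective Xs ds \<alpha> \<gamma> \<le> rmp_objective Xs ds \<alpha>' \<gamma>')"

definition pricing_matrix :: "(nat \<Rightarrow> real) \<Rightarrow> (nat \<Rightarrow> real) \<Rightarrow> 'a" where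
  "pricing_matrix \<mu>l \<mu>u = - A 0 + (\<Sum>i=1..m. (\<mu>l i - \<mu>u i) *\<^sub>R A i)"

text \<open>
  Multipliers of infinite bounds are forced to be 0, so the value (0) of \<open>real_of_ereal\<close> at an
  infinite bound plays no role in the dual objective.
\<close>
definition dual_objective :: "real \<Rightarrow> (nat \<Rightarrow> real) \<Rightarrow> (nat \<Rightarrow> real) \<Rightarrow> real" where
  "dual_objective \<nu> \<mu>l \<mu>u =
     - \<nu> + (\<Sum>i=1..m. real_of_ereal (bl i) * \<mu>l i) - (\<Sum>i=1..m. real_of_ereal (bu i) * \<mu>u i)"

definition dual_feasible ::
    "'a list \<Rightarrow> 'a list \<Rightarrow> real \<Rightarrow> (nat \<Rightarrow> real) \<Rightarrow> (nat \<Rightarrow> real) \<Rightarrow> bool" where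
  "dual_feasible Xs ds \<nu> \<mu>l \<mu>u \<longleftrightarrow>
     (\<forall>i\<in>{1..m}. 0 \<le> \<mu>l i \<and> 0 \<le> \<mu>u i \<and>
        (\<bar>bl i\<bar> = \<infinity> \<longrightarrow> \<mu>l i = 0) \<and> (\<bar>bu i\<bar> = \<infinity> \<longrightarrow> \<mu>u i = 0)) \<and>
     (\<forall>X\<in>set Xs. pricing_matrix \<mu>l \<mu>u \<bullet> X \<le> \<nu>) \<and>
     (\<forall>d\<in>set ds. pricing_matrix \<mu>l \<mu>u \<bullet> d \<le> 0)"

definition dual_optimal ::
    "'a list \<Rightarrow> 'a list \<Rightarrow> real \<Rightarrow> (nat \<Rightarrow> real) \<Rightarrow> (nat \<Rightarrow> real) \<Rightarrow> bool" where
  "dual_optimal Xs ds \<nu> \<mu>l \<mu>u \<longleftrightarrow> dual_feasible Xs ds \<nu> \<mu>l \<mu>u \<and>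
     (\<forall>\<nu>' \<mu>l' \<mu>u'. dual_feasible Xs ds \<nu>' \<mu>l' \<mu>u' \<longrightarrow>
        dual_objective \<nu>' \<mu>l' \<mu>u' \<le> dual_objective \<nu> \<mu>l \<mu>u)"

definition V_P :: "(nat \<Rightarrow> real) \<Rightarrow> (nat \<Rightarrow> real) \<Rightarrow> ereal" where
  "V_P \<mu>l \<mu>u = (SUP X\<in>convex hull D. ereal (pricing_matrix \<mu>l \<mu>u \<bullet> X))"

text \<open>
  \<open>cg_state \<epsilon> Xs ds\<close>: the lists \<open>Xs\<close> of points and \<open>ds\<close> of directions can occur at the beginning of
  an iteration. All choices made by the algorithm (initial point, optimal solutions of the linear
  programs and of the pricing problem, recession directions) are nondeterministic.
\<close>
inductive cg_state :: "real \<Rightarrow> 'a list \<Rightarrow> 'a list \<Rightarrow> bool" for \<epsilon> :: real where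
  init: "feasible X\<^sub>1 \<Longrightarrow> cg_state \<epsilon> [X\<^sub>1] []"
| add_direction:
    "\<lbrakk>cg_state \<epsilon> Xs ds; rmp_optimal Xs ds \<alpha> \<gamma>; dual_optimal Xs ds \<nu> \<mu>l \<mu>u;
      V_P \<mu>l \<mu>u = \<infinity>;
      d \<in> recession_cone (convex hull D); 0 < pricing_matrix \<mu>l \<mu>u \<bullet> d\<rbrakk>
     \<Longrightarrow> cg_state \<epsilon> Xs (ds @ [d])"
| add_point:
    "\<lbrakk>cg_state \<epsilon> Xs ds; rmp_optimal Xs ds \<alpha> \<gamma>; dual_optimal Xs ds \<nu> \<mu>l \<mu>u;
      V_P \<mu>l \<mu>u \<noteq> \<infinity>; ereal (\<nu> + \<epsilon>) < V_P \<mu>l \<mu>u;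
      X \<in> convex hull D; ereal (pricing_matrix \<mu>l \<mu>u \<bullet> X) = V_P \<mu>l \<mu>u\<rbrakk>
     \<Longrightarrow> cg_state \<epsilon> (Xs @ [X]) ds"

definition cg_returns :: "real \<Rightarrow> 'a \<Rightarrow> bool" where
  "cg_returns \<epsilon> X' \<longleftrightarrow>
     (\<exists>Xs ds \<alpha> \<gamma> \<nu> \<mu>l \<mu>u. cg_state \<epsilon> Xs ds \<and>
        rmp_optimal Xs ds \<alpha> \<gamma> \<and> dual_optimal Xs ds \<nu> \<mu>l \<mu>u \<and>
        V_P \<mu>l \<mu>u \<le> ereal (\<nu> + \<epsilon>) \<and>
        X' = (\<Sum>h<length Xs. \<alpha> h *\<^sub>R Xs ! h) + (\<Sum>j<length ds. \<gamma> j *\<^sub>R ds ! j))"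

end

end

theory Submission
  imports Defs
begin

text \<open>
  The returned point is feasible because every point in the list lies in \<open>conv(D)\<close>, every
  direction in the list is a direction of recession of \<open>conv(D)\<close>, and the range constraints of the
  master program say exactly that their combination \<open>X\<^sup>*\<close> satisfies the constraints of LSOP-R. So
  \<open>V_rel\<close> is at most its value.

  For the other bound, let \<open>P = - A\<^sub>0 + \<Sum>\<^sub>i (\<mu>l\<^sub>i - \<mu>u\<^sub>i) A\<^sub>i\<close> be the pricing matrix of the optimal
  multipliers. Any feasible \<open>X\<close> of LSOP-R satisfies \<open>P \<bullet> X \<le> V_P \<le> \<nu> + \<epsilon>\<close> by the
  stopping rule, hence
  \<open>A\<^sub>0 \<bullet> X \<ge> \<Sum>\<^sub>i (\<mu>l\<^sub>i - \<mu>u\<^sub>i) (A\<^sub>i \<bullet> X) - \<nu> - \<epsilon> \<ge> (- \<nu> + bl \<bullet> \<mu>l - bu \<bullet> \<mu>u) - \<epsilon>\<close>.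
  The bracket is the optimal value of the dual master program, and by strong duality of linear
  programming it equals the optimal value \<open>A\<^sub>0 \<bullet> X\<^sup>*\<close> of the master program. The argument sees
  \<open>D\<close> only through the convex set \<open>conv(D)\<close>, so it is carried out in an arbitrary inner product
  space; this treats square and rectangular matrices at once.

  The one substantial ingredient is strong duality, whose source is the lemma of Farkas. The number
  of variables of the master program grows with the iterations, so the lemma is stated for matrices
  over finite index sets and not for vectors of a fixed Euclidean space. It is proved by eliminating one inequality at a time (the algebraic argument of Bartl),
  which avoids separation theorems and the closedness of finitely generated cones.
\<close>

section \<open>The lemma of Farkas and linear programming duality\<close>

text \<open>
  Induction on the number of inequalities. If the last inequality \<open>a\<^sub>r\<close> can be dropped, nothing is
  to be done. Otherwise some \<open>x\<^sub>0\<close> satisfies all others and violates the conclusion, so \<open>a\<^sub>r x\<^sub>0 > 0\<close>.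
  The projection \<open>y \<mapsto> y - a\<^sub>r(y) x\<^sub>0\<close> (after scaling \<open>x\<^sub>0\<close> to \<open>a\<^sub>r x\<^sub>0 = 1\<close>) onto the kernel of
  \<open>a\<^sub>r\<close> yields a system without \<open>a\<^sub>r\<close> to which the induction hypothesis applies; the multiplier of
  \<open>a\<^sub>r\<close> is then nonnegative by the choice of \<open>x\<^sub>0\<close>.
\<close>

lemma farkas:
  fixes a :: "'j \<Rightarrow> 'i \<Rightarrow> real" and g :: "'i \<Rightarrow> real"
  assumes finI: "finite I" and "finite J"
    and "\<And>x. (\<forall>j\<in>J. (\<Sum>i\<in>I. a j i * x i) \<le> 0) \<Longrightarrow> (\<Sum>i\<in>I. g i * x i) \<le> 0"
  shows "\<exists>w. (\<forall>j\<in>J. 0 \<le> w j) \<and> (\<forall>i\<in>I. g i = (\<Sum>j\<in>J. w j * a j i))"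
  using assms(2,3)
proof (induction J arbitrary: a g rule: finite_induct)
  case empty
  have "(\<Sum>i\<in>I. g i * g i) \<le> 0"
    using empty by simp
  then have "(\<Sum>i\<in>I. g i * g i) = 0"
    by (intro antisym sum_nonneg) auto
  then show ?case
    using finI by (simp add: sum_nonneg_eq_0_iff)
next
  case (insert r J)
  show ?case
  proof (cases "\<forall>x. (\<forall>j\<in>J. (\<Sum>i\<in>I. a j i * x i) \<le> 0) \<longrightarrow> (\<Sum>i\<in>I. g i * x i) \<le> 0")
    case True
    then obtain w where w: "\<forall>j\<in>J. 0 \<le> w j" "\<forall>i\<in>I. g i = (\<Sum>j\<in>J. w j * a j i)"
      using insert.IH[of a g] by blast
    have "(\<Sum>j\<in>insert r J. (w(r := 0)) j * a j i) = (\<Sum>j\<in>J. w j * a j i)" for i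
      using insert.hyps by (auto intro!: sum.cong)
    with w show ?thesis
      by (intro exI[of _ "w(r := 0)"]) auto
  next
    case False
    then obtain x where x: "\<forall>j\<in>J. (\<Sum>i\<in>I. a j i * x i) \<le> 0" "0 < (\<Sum>i\<in>I. g i * x i)"
      by force
    define s where "s = (\<Sum>i\<in>I. a r i * x i)"
    have "0 < s"
    proof (rule ccontr)
      assume "\<not> 0 < s"
      then have "(\<Sum>i\<in>I. g i * x i) \<le> 0"
        using x(1) insert.prems[of x] by (auto simp: s_def)
      with x(2) show False by simp
    qed
    define x0 where "x0 i = x i / s" for i
    have scale: "(\<Sum>i\<in>I. c i * x0 i) = (\<Sum>i\<in>I. c i * x i) / s" for c
      by (simp add: x0_def sum_divide_distrib)
    have r0: "(\<Sum>i\<in>I. a r i * x0 i) = 1"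
      using \<open>0 < s\<close> by (simp add: scale s_def)
    have J0: "(\<Sum>i\<in>I. a j i * x0 i) \<le> 0" if "j \<in> J" for j
      using x(1) that \<open>0 < s\<close> by (simp add: scale divide_nonpos_pos)
    have g0: "0 \<le> (\<Sum>i\<in>I. g i * x0 i)"
      using x(2) \<open>0 < s\<close> by (simp add: scale)
    \<comment> \<open>The functional \<open>c\<close> composed with the projection onto the kernel of \<open>a r\<close> along \<open>x0\<close>.\<close>
    define pr where "pr c i = c i - (\<Sum>k\<in>I. c k * x0 k) * a r i" for c :: "'i \<Rightarrow> real" and i
    have shift: "(\<Sum>i\<in>I. c i * (y i - t * x0 i)) = (\<Sum>i\<in>I. c i * y i) - t * (\<Sum>i\<in>I. c i * x0 i)"
      for c y :: "'i \<Rightarrow> real" and t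
      by (simp add: right_diff_distrib sum_subtractf sum_distrib_left mult.left_commute)
    have pr: "(\<Sum>i\<in>I. pr c i * y i) = (\<Sum>i\<in>I. c i * (y i - (\<Sum>k\<in>I. a r k * y k) * x0 i))" for c y
    proof -
      have "(\<Sum>i\<in>I. pr c i * y i) =
          (\<Sum>i\<in>I. c i * y i) - (\<Sum>k\<in>I. c k * x0 k) * (\<Sum>i\<in>I. a r i * y i)"
        by (simp add: pr_def left_diff_distrib sum_subtractf sum_distrib_left mult.assoc)
      then show ?thesis
        by (simp only: shift) (simp only: mult.commute[of "\<Sum>i\<in>I. a r i * y i"])
    qed
    have "(\<Sum>i\<in>I. pr g i * y i) \<le> 0" if y: "\<forall>j\<in>J. (\<Sum>i\<in>I. pr (a j) i * y i) \<le> 0" for y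
    proof -
      define y' where "y' i = y i - (\<Sum>k\<in>I. a r k * y k) * x0 i" for i
      have "(\<Sum>i\<in>I. a r i * y' i) = 0"
        by (simp add: y'_def shift r0)
      moreover have "(\<Sum>i\<in>I. a j i * y' i) \<le> 0" if "j \<in> J" for j
        using y that by (simp add: pr y'_def)
      ultimately have "(\<Sum>i\<in>I. g i * y' i) \<le> 0"
        by (intro insert.prems) auto
      then show ?thesis
        by (simp add: pr y'_def)
    qed
    then obtain w where w: "\<forall>j\<in>J. 0 \<le> w j" "\<forall>i\<in>I. pr g i = (\<Sum>j\<in>J. w j * pr (a j) i)"
      using insert.IH[of "\<lambda>j. pr (a j)" "pr g"] by blast
    define t where "t = (\<Sum>i\<in>I. g i * x0 i) - (\<Sum>j\<in>J. w j * (\<Sum>i\<in>I. a j i * x0 i))"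
    have "(\<Sum>j\<in>J. w j * (\<Sum>i\<in>I. a j i * x0 i)) \<le> 0"
      using w(1) J0 by (blast intro: sum_nonpos mult_nonneg_nonpos)
    then have "0 \<le> t"
      using g0 by (simp add: t_def)
    moreover have "g i = (\<Sum>j\<in>insert r J. (w(r := t)) j * a j i)" if "i \<in> I" for i
    proof -
      have "(\<Sum>j\<in>insert r J. (w(r := t)) j * a j i) = t * a r i + (\<Sum>j\<in>J. w j * a j i)"
        using insert.hyps by (auto intro!: sum.cong)
      moreover have "(\<Sum>j\<in>J. w j * pr (a j) i) =
          (\<Sum>j\<in>J. w j * a j i) - (\<Sum>j\<in>J. w j * (\<Sum>k\<in>I. a j k * x0 k)) * a r i"
        by (simp add: pr_def right_diff_distrib sum_subtractf sum_distrib_right mult.assoc)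
      moreover have "g i - (\<Sum>k\<in>I. g k * x0 k) * a r i = (\<Sum>j\<in>J. w j * pr (a j) i)"
        using bspec[OF w(2) that] by (simp only: pr_def[of g])
      moreover have "t * a r i = (\<Sum>k\<in>I. g k * x0 k) * a r i
          - (\<Sum>j\<in>J. w j * (\<Sum>k\<in>I. a j k * x0 k)) * a r i"
        by (simp only: t_def left_diff_distrib)
      ultimately show ?thesis
        by linarith
    qed
    ultimately show ?thesis
      using w(1) by (intro exI[of _ "w(r := t)"]) auto
  qed
qed

text \<open>
  Homogenisation: one further variable \<open>t = x None \<ge> 0\<close> turns the right-hand sides into
  coefficients, and row \<open>None\<close> of the new system expresses \<open>- t \<le> 0\<close>. For
  \<open>t > 0\<close> the implication needed for the homogeneous lemma is the given one at \<open>x / t\<close>; for \<open>t = 0\<close> the vector \<open>x\<close> is a direction of recession of the polyhedron, which is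
  nonempty, so \<open>g\<close> would be unbounded on it if \<open>g\<close> increased along \<open>x\<close>.
\<close>

lemma affine_farkas:
  fixes a :: "'j \<Rightarrow> 'i \<Rightarrow> real" and g :: "'i \<Rightarrow> real"
  assumes fin: "finite I" "finite J"
    and feas: "\<And>j. j \<in> J \<Longrightarrow> (\<Sum>i\<in>I. a j i * x0 i) \<le> b j"
    and bound: "\<And>x. (\<forall>j\<in>J. (\<Sum>i\<in>I. a j i * x i) \<le> b j) \<Longrightarrow> (\<Sum>i\<in>I. g i * x i) \<le> v"
  shows "\<exists>w. (\<forall>j\<in>J. 0 \<le> w j) \<and> (\<forall>i\<in>I. g i = (\<Sum>j\<in>J. w j * a j i)) \<and> (\<Sum>j\<in>J. w j * b j) \<le> v"
proof -
  define ext where "ext c d = case_option (- d) c" for c :: "'i \<Rightarrow> real" and d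
  define a' where "a' = case_option (ext (\<lambda>_. 0) 1) (\<lambda>j. ext (a j) (b j))"
  have split: "(\<Sum>n\<in>insert None (Some ` N). f n) = f None + (\<Sum>n\<in>N. f (Some n))"
    if "finite N" for f :: "'n option \<Rightarrow> real" and N
    using that by (subst sum.insert) (auto simp: sum.reindex)
  have "(\<Sum>i\<in>insert None (Some ` I). ext g v i * x i) \<le> 0"
    if x: "\<forall>j\<in>insert None (Some ` J). (\<Sum>i\<in>insert None (Some ` I). a' j i * x i) \<le> 0" for x
  proof -
    define t and y where "t = x None" and "y i = x (Some i)" for i
    have "(\<Sum>i\<in>insert None (Some ` I). a' None i * x i) \<le> 0"
      using x by blast
    then have t: "0 \<le> t"
      by (simp only: split[OF fin(1)]) (simp add: a'_def ext_def t_def)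
    have y: "(\<Sum>i\<in>I. a j i * y i) \<le> b j * t" if "j \<in> J" for j
    proof -
      have "(\<Sum>i\<in>insert None (Some ` I). a' (Some j) i * x i) \<le> 0"
        using x that by blast
      then show ?thesis
        by (simp only: split[OF fin(1)]) (simp add: a'_def ext_def t_def y_def)
    qed
    have "(\<Sum>i\<in>I. g i * y i) \<le> v * t"
    proof (cases "t = 0")
      case True
      have ray: "(\<Sum>i\<in>I. g i * x0 i) + s * (\<Sum>i\<in>I. g i * y i) \<le> v" if "0 \<le> s" for s
      proof -
        have "(\<Sum>i\<in>I. a j i * (x0 i + s * y i)) \<le> b j" if "j \<in> J" for j
        proof -
          have "s * (\<Sum>i\<in>I. a j i * y i) \<le> 0"
            using y[OF that] True \<open>0 \<le> s\<close> by (simp add: mult_nonneg_nonpos)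
          then show ?thesis
            using feas[OF that]
            by (simp add: distrib_left sum.distrib sum_distrib_left mult.left_commute)
        qed
        then have "(\<Sum>i\<in>I. g i * (x0 i + s * y i)) \<le> v"
          by (intro bound) auto
        then show ?thesis
          by (simp add: distrib_left sum.distrib sum_distrib_left mult.left_commute)
      qed
      have "(\<Sum>i\<in>I. g i * y i) \<le> 0"
      proof (rule ccontr)
        assume "\<not> ?thesis"
        then have pos: "0 < (\<Sum>i\<in>I. g i * y i)" by simp
        \<comment> \<open>The step at which the objective on the ray reaches \<open>v + 1\<close>.\<close>
        define s where "s = (v - (\<Sum>i\<in>I. g i * x0 i) + 1) / (\<Sum>i\<in>I. g i * y i)"
        have "0 \<le> s"
          using ray[of 0] pos by (simp add: s_def)
        then show False
          using ray[of s] pos by (simp add: s_def)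
      qed
      with True show ?thesis by simp
    next
      case False
      with t have "0 < t" by simp
      have scale: "(\<Sum>i\<in>I. c i * (y i / t)) = (\<Sum>i\<in>I. c i * y i) / t" for c
        by (simp add: sum_divide_distrib)
      have "(\<Sum>i\<in>I. g i * (y i / t)) \<le> v"
        using y \<open>0 < t\<close> by (intro bound ballI) (simp only: scale, simp add: divide_le_eq)
      then show ?thesis
        using \<open>0 < t\<close> by (simp only: scale) (simp add: divide_le_eq)
    qed
    then show ?thesis
      by (simp only: split[OF fin(1)]) (simp add: ext_def t_def y_def)
  qed
  then obtain w where nonneg: "\<forall>j\<in>insert None (Some ` J). 0 \<le> w j"
    and eq: "\<forall>i\<in>insert None (Some ` I). ext g v i = (\<Sum>j\<in>insert None (Some ` J). w j * a' j i)"
    using farkas[of "insert None (Some ` I)" "insert None (Some ` J)" a' "ext g v"] fin by blast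
  have "v = w None + (\<Sum>j\<in>J. w (Some j) * b j)"
    using bspec[OF eq, of None]
    by (simp only: split[OF fin(2)]) (simp add: a'_def ext_def sum_negf)
  moreover have "g i = (\<Sum>j\<in>J. w (Some j) * a j i)" if "i \<in> I" for i
    using bspec[OF eq, of "Some i"] that
    by (simp only: split[OF fin(2)]) (simp add: a'_def ext_def)
  ultimately show ?thesis
    using nonneg by (intro exI[of _ "\<lambda>j. w (Some j)"]) auto
qed

text \<open>
  Only finite bounds give real inequalities to which \<open>affine_farkas\<close> applies;
  the multipliers of infinite bounds are then filled in by \<open>0\<close>. Discarding the row of a bound \<open>l k = \<infinity>\<close> or \<open>u k = -\<infinity>\<close> would
  change the feasible set, but feasibility of \<open>z0\<close> excludes these. The multipliers of \<open>z \<ge> 0\<close> are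
  the slacks in the dual inequalities.
\<close>

lemma lp_strong_duality_range_constraints:
  fixes a :: "'k \<Rightarrow> 'i \<Rightarrow> real" and c :: "'i \<Rightarrow> real" and l u :: "'k \<Rightarrow> ereal"
    and I :: "'i set" and K :: "'k set"
  defines "feas \<equiv> \<lambda>z. (\<forall>i\<in>I. 0 \<le> z i) \<and>
    (\<forall>k\<in>K. l k \<le> ereal (\<Sum>i\<in>I. a k i * z i) \<and> ereal (\<Sum>i\<in>I. a k i * z i) \<le> u k)"
  assumes fin: "finite I" "finite K"
    and z0: "feas z0"
    and bound: "\<And>z. feas z \<Longrightarrow> v \<le> (\<Sum>i\<in>I. c i * z i)"
  shows "\<exists>\<mu>l \<mu>u.
    (\<forall>k\<in>K. 0 \<le> \<mu>l k \<and> 0 \<le> \<mu>u k \<and>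
      (\<bar>l k\<bar> = \<infinity> \<longrightarrow> \<mu>l k = 0) \<and> (\<bar>u k\<bar> = \<infinity> \<longrightarrow> \<mu>u k = 0)) \<and>
    (\<forall>i\<in>I. (\<Sum>k\<in>K. (\<mu>l k - \<mu>u k) * a k i) \<le> c i) \<and>
    v \<le> (\<Sum>k\<in>K. real_of_ereal (l k) * \<mu>l k) - (\<Sum>k\<in>K. real_of_ereal (u k) * \<mu>u k)"
proof -
  define L where "L = {k\<in>K. \<bar>l k\<bar> \<noteq> \<infinity>}"
  define U where "U = {k\<in>K. \<bar>u k\<bar> \<noteq> \<infinity>}"
  have finLU: "finite L" "finite U"
    using fin by (auto simp: L_def U_def)
  define row where "row = case_sum (\<lambda>k i. - a k i) (case_sum a (\<lambda>n i. if i = n then -1 else 0))"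
  define rhs where "rhs = case_sum (\<lambda>k. - real_of_ereal (l k)) (case_sum (\<lambda>k. real_of_ereal (u k)) (\<lambda>n::'i. 0))"
  have unit_row: "(\<Sum>i\<in>I. (if i = n then -1 else 0) * z i) = - z n" if "n \<in> I" for n and z :: "'i \<Rightarrow> real"
    using that fin by (simp add: if_distrib[of "\<lambda>x. x * _"] cong: if_cong)
  have rows: "feas z \<longleftrightarrow> (\<forall>j\<in>L <+> (U <+> I). (\<Sum>i\<in>I. row j i * z i) \<le> rhs j)" (is "_ \<longleftrightarrow> ?R") for z
  proof -
    have "l k \<le> ereal s \<longleftrightarrow> (k \<in> L \<longrightarrow> real_of_ereal (l k) \<le> s)" if "k \<in> K" for k s
      using z0 that by (cases "l k") (auto simp: feas_def L_def)
    moreover have "ereal s \<le> u k \<longleftrightarrow> (k \<in> U \<longrightarrow> s \<le> real_of_ereal (u k))" if "k \<in> K" for k s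
      using z0 that by (cases "u k") (auto simp: feas_def U_def)
    moreover have "?R \<longleftrightarrow> (\<forall>k\<in>L. real_of_ereal (l k) \<le> (\<Sum>i\<in>I. a k i * z i)) \<and>
        (\<forall>k\<in>U. (\<Sum>i\<in>I. a k i * z i) \<le> real_of_ereal (u k)) \<and> (\<forall>i\<in>I. 0 \<le> z i)"
      by (auto simp: row_def rhs_def unit_row sum_negf Plus_def ball_Un)
    moreover have "L \<subseteq> K" "U \<subseteq> K"
      by (auto simp: L_def U_def)
    ultimately show ?thesis
      unfolding feas_def by (simp only:) blast
  qed
  have "\<exists>w. (\<forall>j\<in>L <+> (U <+> I). 0 \<le> w j) \<and>
      (\<forall>i\<in>I. - c i = (\<Sum>j\<in>L <+> (U <+> I). w j * row j i)) \<and>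
      (\<Sum>j\<in>L <+> (U <+> I). w j * rhs j) \<le> - v"
  proof (rule affine_farkas)
    show "(\<Sum>i\<in>I. row j i * z0 i) \<le> rhs j" if "j \<in> L <+> (U <+> I)" for j
      using z0 that rows by blast
    show "(\<Sum>i\<in>I. - c i * z i) \<le> - v"
      if "\<forall>j\<in>L <+> (U <+> I). (\<Sum>i\<in>I. row j i * z i) \<le> rhs j" for z
      using bound[of z] rows that by (simp add: sum_negf)
  qed (use fin finLU in auto)
  then obtain w where nonneg: "\<forall>j\<in>L <+> (U <+> I). 0 \<le> w j"
    and eq: "\<forall>i\<in>I. - c i = (\<Sum>j\<in>L <+> (U <+> I). w j * row j i)"
    and le: "(\<Sum>j\<in>L <+> (U <+> I). w j * rhs j) \<le> - v"
    by blast
  define \<mu>l where "\<mu>l k = (if k \<in> L then w (Inl k) else 0)" for k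
  define \<mu>u where "\<mu>u k = (if k \<in> U then w (Inr (Inl k)) else 0)" for k
  have sumL: "(\<Sum>k\<in>L. w (Inl k) * f k) = (\<Sum>k\<in>K. \<mu>l k * f k)" for f
    using fin by (intro sum.mono_neutral_cong_left) (auto simp: \<mu>l_def L_def)
  have sumU: "(\<Sum>k\<in>U. w (Inr (Inl k)) * f k) = (\<Sum>k\<in>K. \<mu>u k * f k)" for f
    using fin by (intro sum.mono_neutral_cong_left) (auto simp: \<mu>u_def U_def)
  have "(\<Sum>k\<in>K. (\<mu>l k - \<mu>u k) * a k i) \<le> c i" if "i \<in> I" for i
  proof -
    have "(\<Sum>n\<in>I. w (Inr (Inr n)) * (if i = n then -1 else 0)) = - w (Inr (Inr i))"
      using that fin by (simp add: if_distrib[of "\<lambda>x. _ * x"] cong: if_cong)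
    then have "- c i = - (\<Sum>k\<in>K. \<mu>l k * a k i) + (\<Sum>k\<in>K. \<mu>u k * a k i) - w (Inr (Inr i))"
      using bspec[OF eq that] fin finLU
      by (simp add: sum.Plus row_def sum_negf sumL sumU)
    moreover have "0 \<le> w (Inr (Inr i))"
      using nonneg that by auto
    ultimately show ?thesis
      by (simp add: left_diff_distrib sum_subtractf)
  qed
  moreover have "v \<le> (\<Sum>k\<in>K. real_of_ereal (l k) * \<mu>l k) - (\<Sum>k\<in>K. real_of_ereal (u k) * \<mu>u k)"
    using le fin finLU 
    by (simp add: sum.Plus rhs_def sum_negf sumL sumU) (simp add: mult.commute)
  ultimately show ?thesis
    using nonneg by (intro exI[of _ \<mu>l] exI[of _ \<mu>u]) (auto simp: \<mu>l_def \<mu>u_def L_def U_def)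
qed

section \<open>Correctness of column generation\<close>

lemma recession_combination_mem:
  fixes C :: "'a::real_vector set"
  assumes "x \<in> C" and "set ds \<subseteq> recession_cone C" and "\<And>j. j < length ds \<Longrightarrow> 0 \<le> \<gamma> j"
  shows "x + (\<Sum>j<length ds. \<gamma> j *\<^sub>R ds ! j) \<in> C"
proof -
  have "x + (\<Sum>j<n. \<gamma> j *\<^sub>R ds ! j) \<in> C" if "n \<le> length ds" for n
    using that
  proof (induction n)
    case 0
    then show ?case using assms(1) by simp
  next
    case (Suc n)
    then have "ds ! n \<in> recession_cone C"
      using assms(2) by (auto dest: nth_mem)
    then have "x + (\<Sum>j<n. \<gamma> j *\<^sub>R ds ! j) + \<gamma> n *\<^sub>R ds ! n \<in> C"
      using Suc assms(3) by (auto simp: recession_cone_def)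
    then show ?case by (simp add: add.assoc)
  qed
  then show ?thesis by blast
qed

context lsop
begin

lemma cg_state_lists:
  assumes "cg_state \<epsilon> Xs ds"
  shows "set Xs \<subseteq> convex hull D" and "set ds \<subseteq> recession_cone (convex hull D)"
proof -
  from assms have "set Xs \<subseteq> convex hull D \<and> set ds \<subseteq> recession_cone (convex hull D)"
    by induction (auto simp: feasible_def)
  then show "set Xs \<subseteq> convex hull D" and "set ds \<subseteq> recession_cone (convex hull D)"
    by auto
qed

lemma rmp_feasible_imp_feasible:
  assumes "set Xs \<subseteq> convex hull D" and "set ds \<subseteq> recession_cone (convex hull D)"
    and rmp: "rmp_feasible Xs ds \<alpha> \<gamma>"
  shows "feasible ((\<Sum>h<length Xs. \<alpha> h *\<^sub>R Xs ! h) + (\<Sum>j<length ds. \<gamma> j *\<^sub>R ds ! j))"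
proof -
  have "(\<Sum>h<length Xs. \<alpha> h *\<^sub>R Xs ! h) \<in> convex hull D"
    using rmp assms(1) by (intro convex_sum) (auto simp: rmp_feasible_def)
  then have "(\<Sum>h<length Xs. \<alpha> h *\<^sub>R Xs ! h) + (\<Sum>j<length ds. \<gamma> j *\<^sub>R ds ! j) \<in> convex hull D"
    using rmp assms(2) by (intro recession_combination_mem) (auto simp: rmp_feasible_def)
  then show ?thesis
    using rmp by (auto simp: feasible_def rmp_feasible_def Let_def inner_add_right inner_sum_right)
qed

lemma inner_pricing_matrix:
  "pricing_matrix \<mu>l \<mu>u \<bullet> X = - (A 0 \<bullet> X) + (\<Sum>i=1..m. (\<mu>l i - \<mu>u i) * (A i \<bullet> X))"
  by (simp add: pricing_matrix_def inner_diff_left inner_sum_left)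

text \<open>
  The master program is brought into the form of the duality lemma by treating the convexity
  constraint as row \<open>0\<close> of the range constraints, with both bounds equal to \<open>1\<close>. The variable \<open>\<nu>\<close>
  of the dual is then the difference of the two multipliers of that row.
\<close>

lemma rmp_strong_duality:
  assumes opt: "rmp_optimal Xs ds \<alpha> \<gamma>"
  shows "\<exists>\<nu> \<mu>l \<mu>u. dual_feasible Xs ds \<nu> \<mu>l \<mu>u \<and> rmp_objective Xs ds \<alpha> \<gamma> \<le> dual_objective \<nu> \<mu>l \<mu>u"
proof -
  define I where "I = {..<length Xs} <+> {..<length ds}"
  define a where "a k = (if k = 0 then case_sum (\<lambda>h. 1) (\<lambda>j. 0)
    else case_sum (\<lambda>h. A k \<bullet> Xs ! h) (\<lambda>j. A k \<bullet> ds ! j))" for k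
  define c where "c = case_sum (\<lambda>h. A 0 \<bullet> Xs ! h) (\<lambda>j. A 0 \<bullet> ds ! j)"
  define l where "l k = (if k = 0 then 1 else bl k)" for k
  define u where "u k = (if k = 0 then 1 else bu k)" for k
  define feas where "feas z \<longleftrightarrow> (\<forall>i\<in>I. 0 \<le> z i) \<and>
    (\<forall>k\<in>{..m}. l k \<le> ereal (\<Sum>i\<in>I. a k i * z i) \<and> ereal (\<Sum>i\<in>I. a k i * z i) \<le> u k)" for z
  have rows: "{..m} = insert 0 {1..m}" by auto
  have feas_iff: "feas z \<longleftrightarrow> rmp_feasible Xs ds (z \<circ> Inl) (z \<circ> Inr)" for z
  proof -
    have "(\<Sum>i\<in>I. a 0 i * z i) = (\<Sum>h<length Xs. z (Inl h))"
      by (simp add: I_def sum.Plus a_def)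
    moreover have "(\<Sum>i\<in>I. a k i * z i) =
        (\<Sum>h<length Xs. z (Inl h) * (A k \<bullet> Xs ! h)) + (\<Sum>j<length ds. z (Inr j) * (A k \<bullet> ds ! j))"
      if "k \<noteq> 0" for k
      using that by (simp add: I_def sum.Plus a_def mult.commute)
    moreover have "(\<forall>i\<in>I. 0 \<le> z i) \<longleftrightarrow> (\<forall>h<length Xs. 0 \<le> z (Inl h)) \<and> (\<forall>j<length ds. 0 \<le> z (Inr j))"
      by (auto simp: I_def)
    ultimately show ?thesis
      unfolding feas_def rmp_feasible_def rows
      by (auto simp: l_def u_def Let_def one_ereal_def)
  qed
  have obj: "(\<Sum>i\<in>I. c i * z i) = rmp_objective Xs ds (z \<circ> Inl) (z \<circ> Inr)" for z
    by (simp add: I_def sum.Plus c_def rmp_objective_def mult.commute)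
  define v where "v = rmp_objective Xs ds \<alpha> \<gamma>"
  have "feas (case_sum \<alpha> \<gamma>)"
    using opt by (simp add: feas_iff rmp_optimal_def comp_def)
  moreover have "v \<le> (\<Sum>i\<in>I. c i * z i)" if "feas z" for z
    using opt that by (simp add: feas_iff obj rmp_optimal_def v_def)
  moreover have "finite I"
    by (simp add: I_def)
  ultimately obtain \<mu>l \<mu>u where \<mu>: "\<forall>k\<in>{..m}. 0 \<le> \<mu>l k \<and> 0 \<le> \<mu>u k \<and>
      (\<bar>l k\<bar> = \<infinity> \<longrightarrow> \<mu>l k = 0) \<and> (\<bar>u k\<bar> = \<infinity> \<longrightarrow> \<mu>u k = 0)"
    and slack: "\<forall>i\<in>I. (\<Sum>k\<in>{..m}. (\<mu>l k - \<mu>u k) * a k i) \<le> c i"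
    and val: "v \<le> (\<Sum>k\<in>{..m}. real_of_ereal (l k) * \<mu>l k) - (\<Sum>k\<in>{..m}. real_of_ereal (u k) * \<mu>u k)"
    using lp_strong_duality_range_constraints[where I = I and K = "{..m}" and a = a and c = c and l = l
        and u = u and v = v and ?z0.0 = "case_sum \<alpha> \<gamma>"]
    unfolding feas_def by blast
  define \<nu> where "\<nu> = \<mu>u 0 - \<mu>l 0"
  have "pricing_matrix \<mu>l \<mu>u \<bullet> Xs ! h \<le> \<nu>" if "h < length Xs" for h
  proof -
    have "(\<Sum>k\<in>{..m}. (\<mu>l k - \<mu>u k) * a k (Inl h)) \<le> c (Inl h)"
      using slack that by (auto simp: I_def)
    moreover have "(\<Sum>k=1..m. (\<mu>l k - \<mu>u k) * a k (Inl h)) = (\<Sum>k=1..m. (\<mu>l k - \<mu>u k) * (A k \<bullet> Xs ! h))"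
      by (intro sum.cong) (auto simp: a_def)
    ultimately show ?thesis
      by (simp add: rows inner_pricing_matrix a_def[of 0] c_def \<nu>_def)
  qed
  moreover have "pricing_matrix \<mu>l \<mu>u \<bullet> ds ! j \<le> 0" if "j < length ds" for j
  proof -
    have "(\<Sum>k\<in>{..m}. (\<mu>l k - \<mu>u k) * a k (Inr j)) \<le> c (Inr j)"
      using slack that by (auto simp: I_def)
    moreover have "(\<Sum>k=1..m. (\<mu>l k - \<mu>u k) * a k (Inr j)) = (\<Sum>k=1..m. (\<mu>l k - \<mu>u k) * (A k \<bullet> ds ! j))"
      by (intro sum.cong) (auto simp: a_def)
    ultimately show ?thesis
      by (simp add: rows inner_pricing_matrix a_def[of 0] c_def)
  qed
  moreover have "\<forall>k\<in>{1..m}. 0 \<le> \<mu>l k \<and> 0 \<le> \<mu>u k \<and>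
      (\<bar>bl k\<bar> = \<infinity> \<longrightarrow> \<mu>l k = 0) \<and> (\<bar>bu k\<bar> = \<infinity> \<longrightarrow> \<mu>u k = 0)"
    using \<mu> by (auto simp: l_def u_def)
  ultimately have "dual_feasible Xs ds \<nu> \<mu>l \<mu>u"
    unfolding dual_feasible_def by (auto simp: in_set_conv_nth)
  moreover have "v \<le> dual_objective \<nu> \<mu>l \<mu>u"
  proof -
    have "(\<Sum>k=1..m. real_of_ereal (l k) * \<mu>l k) = (\<Sum>k=1..m. real_of_ereal (bl k) * \<mu>l k)"
      "(\<Sum>k=1..m. real_of_ereal (u k) * \<mu>u k) = (\<Sum>k=1..m. real_of_ereal (bu k) * \<mu>u k)"
      by (intro sum.cong; simp add: l_def u_def)+
    then show ?thesis
      using val by (simp add: rows l_def[of 0] u_def[of 0] dual_objective_def \<nu>_def)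
  qed
  ultimately show ?thesis
    unfolding v_def by blast
qed

text \<open>
  Weak Lagrangian duality for LSOP-R itself. Dual feasibility bounds the pricing objective by \<open>\<nu>\<close>
  only at the listed points; the stopping rule bounds it by \<open>\<nu> + \<epsilon>\<close> on all of \<open>conv(D)\<close>, and the
  difference \<open>\<epsilon>\<close> is the whole loss. Nonnegative multipliers turn the bounds on \<open>A i \<bullet> X\<close> into the bound
  terms of the dual objective.
\<close>

lemma dual_objective_le_objective:
  assumes dual: "dual_feasible Xs ds \<nu> \<mu>l \<mu>u" and price: "V_P \<mu>l \<mu>u \<le> ereal (\<nu> + \<epsilon>)"
    and X: "feasible X"
  shows "dual_objective \<nu> \<mu>l \<mu>u - \<epsilon> \<le> A 0 \<bullet> X"
proof -
  have "ereal (pricing_matrix \<mu>l \<mu>u \<bullet> X) \<le> V_P \<mu>l \<mu>u"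
    unfolding V_P_def using X by (intro SUP_upper) (simp add: feasible_def)
  then have "pricing_matrix \<mu>l \<mu>u \<bullet> X \<le> \<nu> + \<epsilon>"
    using price order_trans by fastforce
  then have "- (A 0 \<bullet> X) + (\<Sum>i=1..m. (\<mu>l i - \<mu>u i) * (A i \<bullet> X)) \<le> \<nu> + \<epsilon>"
    by (simp only: inner_pricing_matrix)
  moreover have "(\<Sum>i=1..m. real_of_ereal (bl i) * \<mu>l i - real_of_ereal (bu i) * \<mu>u i)
      \<le> (\<Sum>i=1..m. (\<mu>l i - \<mu>u i) * (A i \<bullet> X))"
  proof (rule sum_mono)
    fix i assume i: "i \<in> {1..m}"
    then have bounds: "bl i \<le> ereal (A i \<bullet> X)" "ereal (A i \<bullet> X) \<le> bu i"
      using X by (auto simp: feasible_def)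
    have \<mu>: "0 \<le> \<mu>l i" "0 \<le> \<mu>u i" "\<bar>bl i\<bar> = \<infinity> \<longrightarrow> \<mu>l i = 0" "\<bar>bu i\<bar> = \<infinity> \<longrightarrow> \<mu>u i = 0"
      using dual i by (auto simp: dual_feasible_def)
    have "real_of_ereal (bl i) * \<mu>l i \<le> \<mu>l i * (A i \<bullet> X)"
      using bounds(1) \<mu>(1,3) by (cases "bl i") (auto simp: mult.commute[of "\<mu>l i"] intro: mult_right_mono)
    moreover have "\<mu>u i * (A i \<bullet> X) \<le> real_of_ereal (bu i) * \<mu>u i"
      using bounds(2) \<mu>(2,4) by (cases "bu i") (auto simp: mult.commute[of "\<mu>u i"] intro: mult_right_mono)
    ultimately show "real_of_ereal (bl i) * \<mu>l i - real_of_ereal (bu i) * \<mu>u i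
        \<le> (\<mu>l i - \<mu>u i) * (A i \<bullet> X)"
      by (simp add: left_diff_distrib)
  qed
  ultimately show ?thesis
    by (simp add: dual_objective_def sum_subtractf)
qed

theorem cg_returns_eps_optimal:
  assumes "cg_returns \<epsilon> X'"
  shows "eps_optimal \<epsilon> X'"
proof -
  obtain Xs ds \<alpha> \<gamma> \<nu> \<mu>l \<mu>u where state: "cg_state \<epsilon> Xs ds"
    and rmp: "rmp_optimal Xs ds \<alpha> \<gamma>" and dual: "dual_optimal Xs ds \<nu> \<mu>l \<mu>u"
    and price: "V_P \<mu>l \<mu>u \<le> ereal (\<nu> + \<epsilon>)"
    and X': "X' = (\<Sum>h<length Xs. \<alpha> h *\<^sub>R Xs ! h) + (\<Sum>j<length ds. \<gamma> j *\<^sub>R ds ! j)"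
    using assms unfolding cg_returns_def by blast
  have feas: "feasible X'"
    unfolding X' using cg_state_lists[OF state] rmp
    by (intro rmp_feasible_imp_feasible) (auto simp: rmp_optimal_def)
  have "A 0 \<bullet> X' = rmp_objective Xs ds \<alpha> \<gamma>"
    by (simp add: X' rmp_objective_def inner_add_right inner_sum_right)
  also have "\<dots> \<le> dual_objective \<nu> \<mu>l \<mu>u"
    using rmp_strong_duality[OF rmp] dual unfolding dual_optimal_def by (meson order_trans)
  finally have "A 0 \<bullet> X' - \<epsilon> \<le> A 0 \<bullet> X" if "feasible X" for X
    using dual_objective_le_objective[OF _ price that] dual by (fastforce simp: dual_optimal_def)
  then have "ereal (A 0 \<bullet> X' - \<epsilon>) \<le> V_rel"
    unfolding V_rel_def by (intro INF_greatest) auto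
  then have "ereal (A 0 \<bullet> X') \<le> V_rel + ereal \<epsilon>"
    by (cases V_rel) auto
  moreover have "V_rel \<le> ereal (A 0 \<bullet> X')"
    unfolding V_rel_def using feas by (intro INF_lower) auto
  ultimately show ?thesis
    using feas by (simp add: eps_optimal_def)
qed

end

theorem proposition6:
  fixes k m :: nat
    and f :: "real^'n \<Rightarrow> real"
    and bl bu :: "nat \<Rightarrow> ereal"
    and \<epsilon> :: real
  assumes "1 \<le> k" and "k \<le> CARD('n)" and "CARD('n) \<le> CARD('p)"
    and "continuous_on UNIV f" and "convex_on UNIV f" and "symmetric_function f"
    and "\<And>i. i \<in> {1..m} \<Longrightarrow> bl i \<le> bu i"
    and "0 < \<epsilon>"
  shows
    "(\<forall>Q \<in> {psd_matrices, symmetric_matrices}. \<forall>D (A :: nat \<Rightarrow> real^'n^'n) X.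
        D = spectral_domain Q k f \<longrightarrow>
        (\<forall>i\<le>m. A i \<in> symmetric_matrices) \<longrightarrow>
        \<not> contains_line (convex hull D) \<longrightarrow>
        lsop.V_rel D m A bl bu > -\<infinity> \<longrightarrow>
        lsop.cg_returns D m A bl bu \<epsilon> X \<longrightarrow>
        lsop.eps_optimal D m A bl bu \<epsilon> X)
     \<and>
     (\<forall>D (A :: nat \<Rightarrow> real^'p^'n) X.
        D = singular_domain k f \<longrightarrow>
        \<not> contains_line (convex hull D) \<longrightarrow>
        lsop.V_rel D m A bl bu > -\<infinity> \<longrightarrow>
        lsop.cg_returns D m A bl bu \<epsilon> X \<longrightarrow>
        lsop.eps_optimal D m A bl bu \<epsilon> X)"
  by (intro conjI ballI allI impI; erule lsop.cg_returns_eps_optimal)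

end
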